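(* Let $(M,g)$ be a Riemannian manifold and let $V$ be a proper torse-forming vector field on $(M,g)$, satisfying $\nabla_X V = fX+\theta(X)V$ for every vector field $X$ on $M$, with $\|V\|=e^{\rho}$. Let $\sigma\in C^\infty(M)$. Then $V$ is recurrent with respect to $\tilde g = e^{2\sigma}g$ if and only if $$\operatorname{grad}\sigma = -f e^{-2\rho}\,V .$$
   Context: $\nabla$ is the Levi-Civita connection of $g$; the norm $\|\cdot\|$ and $\operatorname{grad}$ are taken with respect to $g$; $\rho$ is the function on $M$ defined by $\|V\|=e^{\rho}$. A vector field $V$ on a Riemannian manifold $(M,h)$ with Levi-Civita connection $D$ is torse-forming (with respect to $h$) if there are a smooth function $f$ and a $1$-form $\theta$ on $M$ with $D_XV=fX+\theta(X)V$ for all vector fields $X$. It is called proper torse-forming if $f\neq 0$ and the $1$-form $\theta$ is nowhere zero on a dense open subset of $M$. It is called recurrent (with respect to $h$) if $\theta\neq 0$ and $f=0$, so that $D_XV=\theta(X)V$ for all $X$.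
   Formalization: The manifold M is additionally assumed to have dimension at least 2; in dimension 1 the claim fails (e.g. M = R, g = dx^2, V = e^x d/dx, f = 1, theta = (1 - e^{-x})dx, sigma = 0). *)

theory Defs
  imports "HOL-Analysis.Analysis"
begin

section \<open>Smooth maps between Euclidean spaces\<close>

text \<open>
  Class $C^k$ is defined by recursion on directional derivatives; it is only used on open sets.
\<close>

primrec Ck_on ::
  "nat \<Rightarrow> 'a::euclidean_space set \<Rightarrow> ('a \<Rightarrow> 'b::real_normed_vector) \<Rightarrow> bool" where
  "Ck_on 0 S f \<longleftrightarrow> continuous_on S f"
| "Ck_on (Suc k) S f \<longleftrightarrow>
     (\<forall>x\<in>S. f differentiable (at x)) \<and> (\<forall>v. Ck_on k S (\<lambda>x. frechet_derivative f (at x) v))"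

definition smooth_on :: "'a::euclidean_space set \<Rightarrow> ('a \<Rightarrow> 'b::real_normed_vector) \<Rightarrow> bool" where
  "smooth_on S f \<longleftrightarrow> (\<forall>k. Ck_on k S f)"


section \<open>Smooth manifolds\<close>

text \<open>
  The manifold is the whole type \<open>'m\<close> (Hausdorff and second countable by its sort), modelled on
  the Euclidean space \<open>'e\<close>, so that its dimension is \<open>DIM('e)\<close>. Any smooth atlas is allowed; it
  need not be maximal, since all notions below depend only on the structure it generates.
\<close>

type_synonym ('m, 'e) chart = "'m set \<times> ('m \<Rightarrow> 'e)"

definition is_chart ::
  "('m::topological_space, 'e::euclidean_space) chart \<Rightarrow> bool" where
  "is_chart = (\<lambda>(U, \<phi>). open U \<and> open (\<phi> ` U) \<and> homeomorphism U (\<phi> ` U) \<phi> (inv_into U \<phi>))"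

definition smooth_atlas ::
  "('m::{t2_space, second_countable_topology}, 'e::euclidean_space) chart set \<Rightarrow> bool" where
  "smooth_atlas A \<longleftrightarrow>
     (\<forall>c\<in>A. is_chart c) \<and> (\<Union>(U, \<phi>)\<in>A. U) = UNIV \<and>
     (\<forall>(U, \<phi>)\<in>A. \<forall>(W, \<psi>)\<in>A. smooth_on (\<phi> ` (U \<inter> W)) (\<psi> \<circ> inv_into U \<phi>))"

definition smooth_fun ::
  "('m, 'e::euclidean_space) chart set \<Rightarrow> ('m \<Rightarrow> real) \<Rightarrow> bool" where
  "smooth_fun A f \<longleftrightarrow> (\<forall>(U, \<phi>)\<in>A. smooth_on (\<phi> ` U) (f \<circ> inv_into U \<phi>))"


section \<open>Tangent vectors, vector fields, 1-forms\<close>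

text \<open>
  A tangent vector at \<open>p\<close> is a derivation at \<open>p\<close> of the algebra of smooth functions. As functions
  in HOL are total, it is required to be \<open>0\<close> on arguments that are not smooth; this makes equality
  of tangent vectors the usual one.
\<close>

type_synonym 'm tvec = "('m \<Rightarrow> real) \<Rightarrow> real"
type_synonym 'm vfield = "'m \<Rightarrow> 'm tvec"
type_synonym 'm form1 = "'m \<Rightarrow> 'm tvec \<Rightarrow> real"
type_synonym 'm metric2 = "'m \<Rightarrow> 'm tvec \<Rightarrow> 'm tvec \<Rightarrow> real"
type_synonym 'm connection = "'m vfield \<Rightarrow> 'm vfield \<Rightarrow> 'm vfield"

definition tangent_space ::
  "('m, 'e::euclidean_space) chart set \<Rightarrow> 'm \<Rightarrow> 'm tvec set" where
  "tangent_space A p = {v.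
     (\<forall>a b u w. smooth_fun A u \<longrightarrow> smooth_fun A w \<longrightarrow>
        v (\<lambda>q. a * u q + b * w q) = a * v u + b * v w) \<and>
     (\<forall>u w. smooth_fun A u \<longrightarrow> smooth_fun A w \<longrightarrow>
        v (\<lambda>q. u q * w q) = u p * v w + w p * v u) \<and>
     (\<forall>u. \<not> smooth_fun A u \<longrightarrow> v u = 0)}"

definition tlin :: "real \<Rightarrow> 'm tvec \<Rightarrow> real \<Rightarrow> 'm tvec \<Rightarrow> 'm tvec" where
  "tlin a v b w = (\<lambda>u. a * v u + b * w u)"

definition vlin :: "('m \<Rightarrow> real) \<Rightarrow> 'm vfield \<Rightarrow> ('m \<Rightarrow> real) \<Rightarrow> 'm vfield \<Rightarrow> 'm vfield" where
  "vlin a X b Y = (\<lambda>p. tlin (a p) (X p) (b p) (Y p))"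

definition vscale :: "('m \<Rightarrow> real) \<Rightarrow> 'm vfield \<Rightarrow> 'm vfield" where
  "vscale a X = (\<lambda>p u. a p * X p u)"

definition vector_field ::
  "('m, 'e::euclidean_space) chart set \<Rightarrow> 'm vfield \<Rightarrow> bool" where
  "vector_field A X \<longleftrightarrow>
     (\<forall>p. X p \<in> tangent_space A p) \<and> (\<forall>u. smooth_fun A u \<longrightarrow> smooth_fun A (\<lambda>p. X p u))"

definition lie_bracket :: "'m vfield \<Rightarrow> 'm vfield \<Rightarrow> 'm vfield" where
  "lie_bracket X Y = (\<lambda>p u. X p (\<lambda>q. Y q u) - Y p (\<lambda>q. X q u))"

definition one_form ::
  "('m, 'e::euclidean_space) chart set \<Rightarrow> 'm form1 \<Rightarrow> bool" where
  "one_form A \<theta> \<longleftrightarrow>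
     (\<forall>p. \<forall>v\<in>tangent_space A p. \<forall>w\<in>tangent_space A p. \<forall>a b.
        \<theta> p (tlin a v b w) = a * \<theta> p v + b * \<theta> p w) \<and>
     (\<forall>X. vector_field A X \<longrightarrow> smooth_fun A (\<lambda>p. \<theta> p (X p)))"

text \<open>
  The values of \<open>\<theta> p\<close> outside the tangent space at \<open>p\<close> are irrelevant, so a 1-form
  vanishes at \<open>p\<close> iff it vanishes on the tangent space.
\<close>

definition form_nonzero_at ::
  "('m, 'e::euclidean_space) chart set \<Rightarrow> 'm form1 \<Rightarrow> 'm \<Rightarrow> bool" where
  "form_nonzero_at A \<theta> p \<longleftrightarrow> (\<exists>v\<in>tangent_space A p. \<theta> p v \<noteq> 0)"


section \<open>Riemannian metrics, gradients, the Levi-Civita connection\<close>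

definition riemannian_metric ::
  "('m, 'e::euclidean_space) chart set \<Rightarrow> 'm metric2 \<Rightarrow> bool" where
  "riemannian_metric A g \<longleftrightarrow>
     (\<forall>p. \<forall>v\<in>tangent_space A p. \<forall>w\<in>tangent_space A p.
        g p v w = g p w v \<and>
        (\<forall>z\<in>tangent_space A p. \<forall>a b. g p (tlin a v b w) z = a * g p v z + b * g p w z)) \<and>
     (\<forall>p. \<forall>v\<in>tangent_space A p. v \<noteq> (\<lambda>u. 0) \<longrightarrow> g p v v > 0) \<and>
     (\<forall>X Y. vector_field A X \<longrightarrow> vector_field A Y \<longrightarrow> smooth_fun A (\<lambda>p. g p (X p) (Y p)))"

definition metric_norm :: "'m metric2 \<Rightarrow> 'm vfield \<Rightarrow> 'm \<Rightarrow> real" where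
  "metric_norm g X = (\<lambda>p. sqrt (g p (X p) (X p)))"

definition conformal_metric :: "('m \<Rightarrow> real) \<Rightarrow> 'm metric2 \<Rightarrow> 'm metric2" where
  "conformal_metric \<sigma> g = (\<lambda>p v w. exp (2 * \<sigma> p) * g p v w)"

text \<open>\<open>has_gradient A g s G\<close> says \<open>grad s = G\<close>, where \<open>grad s\<close> is the vector field
  determined by \<open>g(grad s, X) = X s\<close> for all \<open>X\<close>; see \<open>has_gradient_unique\<close> below.\<close>

definition has_gradient ::
  "('m, 'e::euclidean_space) chart set \<Rightarrow> 'm metric2 \<Rightarrow> ('m \<Rightarrow> real) \<Rightarrow> 'm vfield \<Rightarrow> bool" where
  "has_gradient A g s G \<longleftrightarrow>
     vector_field A G \<and> (\<forall>X. vector_field A X \<longrightarrow> (\<forall>p. g p (G p) (X p) = X p s))"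

definition affine_connection ::
  "('m, 'e::euclidean_space) chart set \<Rightarrow> 'm connection \<Rightarrow> bool" where
  "affine_connection A D \<longleftrightarrow>
     (\<forall>X Y. vector_field A X \<longrightarrow> vector_field A Y \<longrightarrow> vector_field A (D X Y)) \<and>
     (\<forall>X X' Y a b. vector_field A X \<longrightarrow> vector_field A X' \<longrightarrow> vector_field A Y \<longrightarrow>
        smooth_fun A a \<longrightarrow> smooth_fun A b \<longrightarrow>
        D (vlin a X b X') Y = vlin a (D X Y) b (D X' Y)) \<and>
     (\<forall>X Y Y'. vector_field A X \<longrightarrow> vector_field A Y \<longrightarrow> vector_field A Y' \<longrightarrow>
        D X (vlin (\<lambda>_. 1) Y (\<lambda>_. 1) Y') = vlin (\<lambda>_. 1) (D X Y) (\<lambda>_. 1) (D X Y')) \<and>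
     (\<forall>X Y a. vector_field A X \<longrightarrow> vector_field A Y \<longrightarrow> smooth_fun A a \<longrightarrow>
        D X (vscale a Y) = vlin (\<lambda>p. X p a) Y a (D X Y))"

text \<open>The conditions determine \<open>D X Y\<close> for all vector fields \<open>X\<close>, \<open>Y\<close>; see
  \<open>levi_civita_unique\<close> below.\<close>

definition levi_civita ::
  "('m, 'e::euclidean_space) chart set \<Rightarrow> 'm metric2 \<Rightarrow> 'm connection \<Rightarrow> bool" where
  "levi_civita A g D \<longleftrightarrow>
     affine_connection A D \<and>
     (\<forall>X Y. vector_field A X \<longrightarrow> vector_field A Y \<longrightarrow>
        (\<forall>p u. D X Y p u - D Y X p u = lie_bracket X Y p u)) \<and>
     (\<forall>X Y Z. vector_field A X \<longrightarrow> vector_field A Y \<longrightarrow> vector_field A Z \<longrightarrow>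
        (\<forall>p. X p (\<lambda>q. g q (Y q) (Z q)) = g p (D X Y p) (Z p) + g p (Y p) (D X Z p)))"


section \<open>Torse-forming vector fields\<close>

definition torse_forming ::
  "('m, 'e::euclidean_space) chart set \<Rightarrow> 'm connection \<Rightarrow> 'm vfield \<Rightarrow> ('m \<Rightarrow> real) \<Rightarrow> 'm form1 \<Rightarrow> bool"
  where
  "torse_forming A D V f \<theta> \<longleftrightarrow>
     vector_field A V \<and> smooth_fun A f \<and> one_form A \<theta> \<and>
     (\<forall>X. vector_field A X \<longrightarrow> D X V = vlin f X (\<lambda>p. \<theta> p (X p)) V)"

definition proper_torse_forming ::
  "('m::topological_space, 'e::euclidean_space) chart set \<Rightarrow> 'm connection \<Rightarrow> 'm vfield \<Rightarrow>
    ('m \<Rightarrow> real) \<Rightarrow> 'm form1 \<Rightarrow> bool" where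
  "proper_torse_forming A D V f \<theta> \<longleftrightarrow>
     torse_forming A D V f \<theta> \<and> f \<noteq> (\<lambda>_. 0) \<and>
     (\<exists>S. open S \<and> closure S = UNIV \<and> (\<forall>p\<in>S. form_nonzero_at A \<theta> p))"

definition recurrent ::
  "('m, 'e::euclidean_space) chart set \<Rightarrow> 'm metric2 \<Rightarrow> 'm vfield \<Rightarrow> bool" where
  "recurrent A h V \<longleftrightarrow>
     (\<exists>D \<theta>. levi_civita A h D \<and> torse_forming A D V (\<lambda>_. 0) \<theta> \<and> (\<exists>p. form_nonzero_at A \<theta> p))"


section \<open>Uniqueness of gradients and of the Levi-Civita connection\<close>

lemma Ck_on_cong:
  assumes "open S" "\<And>x. x \<in> S \<Longrightarrow> f x = g x" "Ck_on k S f"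
  shows "Ck_on k S g"
  using assms(2,3)
proof (induction k arbitrary: f g)
  case 0
  then show ?case using continuous_on_cong by (metis Ck_on.simps(1))
next
  case (Suc k)
  have d: "frechet_derivative f (at x) = frechet_derivative g (at x)" if "x \<in> S" for x
    using frechet_derivative_transform_within_open[of f x S g] Suc.prems assms(1) that by auto
  have "g differentiable (at x)" if x: "x \<in> S" for x
  proof -
    have "(f has_derivative frechet_derivative f (at x)) (at x)"
      using Suc.prems(2) x by (simp add: frechet_derivative_works)
    from has_derivative_transform_within_open[OF this assms(1) x Suc.prems(1)]
    show ?thesis by (auto simp: differentiable_def)
  qed
  moreover have "Ck_on k S (\<lambda>x. frechet_derivative g (at x) v)" for v
    by (rule Suc.IH[of "\<lambda>x. frechet_derivative f (at x) v"]) (use Suc.prems d in auto)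
  ultimately show ?case by auto
qed

lemma Ck_on_diff:
  assumes "open S" "Ck_on k S f" "Ck_on k S g"
  shows "Ck_on k S (\<lambda>x. f x - g x)"
  using assms(2,3)
proof (induction k arbitrary: f g)
  case 0
  then show ?case by (auto intro: continuous_on_diff)
next
  case (Suc k)
  have d: "((\<lambda>x. f x - g x) has_derivative
      (\<lambda>v. frechet_derivative f (at x) v - frechet_derivative g (at x) v)) (at x)"
    if "x \<in> S" for x
    using Suc.prems that by (auto intro!: has_derivative_diff simp: frechet_derivative_works)
  have eq: "frechet_derivative (\<lambda>x. f x - g x) (at x) v =
      frechet_derivative f (at x) v - frechet_derivative g (at x) v" if "x \<in> S" for x v
    using frechet_derivative_at[OF d[OF that]] by metis
  have "Ck_on k S (\<lambda>x. frechet_derivative (\<lambda>x. f x - g x) (at x) v)" for v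
  proof (rule Ck_on_cong[OF assms(1)])
    show "Ck_on k S (\<lambda>x. frechet_derivative f (at x) v - frechet_derivative g (at x) v)"
      using Suc.IH Suc.prems by simp
  qed (simp add: eq)
  moreover have "(\<lambda>x. f x - g x) differentiable (at x)" if "x \<in> S" for x
    using d[OF that] by (auto simp: differentiable_def)
  ultimately show ?case by simp
qed

lemma smooth_fun_diff:
  assumes A: "smooth_atlas A" and f: "smooth_fun A f" and h: "smooth_fun A h"
  shows "smooth_fun A (\<lambda>p. f p - h p)"
  unfolding smooth_fun_def smooth_on_def
proof clarify
  fix U \<phi> k assume c: "(U, \<phi>) \<in> A"
  have "open (\<phi> ` U)" using A c by (auto simp: smooth_atlas_def is_chart_def)
  moreover have "Ck_on k (\<phi> ` U) (f \<circ> inv_into U \<phi>)" "Ck_on k (\<phi> ` U) (h \<circ> inv_into U \<phi>)"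
    using f h c unfolding smooth_fun_def smooth_on_def by blast+
  ultimately show "Ck_on k (\<phi> ` U) ((\<lambda>p. f p - h p) \<circ> inv_into U \<phi>)"
    using Ck_on_diff by (fastforce simp: o_def)
qed

lemma tangent_space_diff:
  assumes "v \<in> tangent_space A p" "w \<in> tangent_space A p"
  shows "tlin 1 v (-1) w \<in> tangent_space A p"
  using assms unfolding tangent_space_def tlin_def by (simp add: algebra_simps)

lemma vector_field_diff:
  assumes "smooth_atlas A" "vector_field A X" "vector_field A Y"
  shows "vector_field A (vlin (\<lambda>_. 1) X (\<lambda>_. -1) Y)"
proof -
  have "smooth_fun A (\<lambda>p. vlin (\<lambda>_. 1) X (\<lambda>_. -1) Y p u)" if "smooth_fun A u" for u
    using smooth_fun_diff[OF assms(1), of "\<lambda>p. X p u" "\<lambda>p. Y p u"] assms that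
    by (simp add: vector_field_def vlin_def tlin_def)
  moreover have "vlin (\<lambda>_. 1) X (\<lambda>_. -1) Y p \<in> tangent_space A p" for p
    unfolding vlin_def using assms
    by (intro tangent_space_diff) (simp_all add: vector_field_def)
  ultimately show ?thesis unfolding vector_field_def by blast
qed

lemma vector_field_eqI:
  assumes A: "smooth_atlas A" and g: "riemannian_metric A g"
    and X: "vector_field A X" and Y: "vector_field A Y"
    and eq: "\<And>Z p. vector_field A Z \<Longrightarrow> g p (X p) (Z p) = g p (Y p) (Z p)"
  shows "X = Y"
proof
  fix p
  define Z where "Z = vlin (\<lambda>_. 1) X (\<lambda>_. -1) Y"
  have Z: "vector_field A Z" unfolding Z_def using vector_field_diff A X Y by blast
  have t: "X p \<in> tangent_space A p" "Y p \<in> tangent_space A p" "Z p \<in> tangent_space A p"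
    using X Y Z by (auto simp: vector_field_def)
  have "g p (Z p) (Z p) = g p (tlin 1 (X p) (-1) (Y p)) (Z p)" by (simp add: Z_def vlin_def)
  also have "\<dots> = 1 * g p (X p) (Z p) + (-1) * g p (Y p) (Z p)"
    using g t unfolding riemannian_metric_def by blast
  also have "\<dots> = 0" using eq[OF Z] by simp
  finally have zero: "g p (Z p) (Z p) = 0" .
  have "g p v v > 0" if "v \<in> tangent_space A p" "v \<noteq> (\<lambda>u. 0)" for v
    using g that unfolding riemannian_metric_def by blast
  with t(3) zero have "Z p = (\<lambda>u. 0)" by fastforce
  then have "X p u - Y p u = 0" for u
    by (simp add: Z_def vlin_def tlin_def fun_eq_iff)
  then show "X p = Y p" by (simp add: fun_eq_iff)
qed

lemma has_gradient_unique:
  assumes "smooth_atlas A" "riemannian_metric A g" "has_gradient A g s G" "has_gradient A g s G'"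
  shows "G = G'"
proof (rule vector_field_eqI[OF assms(1,2)])
  show "vector_field A G" "vector_field A G'" using assms(3,4) by (simp_all add: has_gradient_def)
  show "g p (G p) (Z p) = g p (G' p) (Z p)" if "vector_field A Z" for Z p
    using assms(3,4) that by (simp add: has_gradient_def)
qed

lemma levi_civitaD:
  assumes "levi_civita A g D" "vector_field A X" "vector_field A Y"
  shows "vector_field A (D X Y)"
    and "D X Y p u - D Y X p u = lie_bracket X Y p u"
    and "vector_field A Z \<Longrightarrow>
      X p (\<lambda>q. g q (Y q) (Z q)) = g p (D X Y p) (Z p) + g p (Y p) (D X Z p)"
proof -
  note lc = assms(1)[unfolded levi_civita_def]
  show "vector_field A (D X Y)"
    using conjunct1[OF lc, unfolded affine_connection_def, THEN conjunct1] assms(2,3) by simp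
  show "D X Y p u - D Y X p u = lie_bracket X Y p u"
    using conjunct2[OF lc, THEN conjunct1] assms(2,3) by simp
  show "X p (\<lambda>q. g q (Y q) (Z q)) = g p (D X Y p) (Z p) + g p (Y p) (D X Z p)"
    if "vector_field A Z"
    using conjunct2[OF lc, THEN conjunct2] assms(2,3) that by simp
qed

lemma levi_civita_unique:
  assumes A: "smooth_atlas A" and g: "riemannian_metric A g"
    and D: "levi_civita A g D" and D': "levi_civita A g D'"
    and X: "vector_field A X" and Y: "vector_field A Y"
  shows "D X Y = D' X Y"
proof -
  have vf: "vector_field A (D X Y)" "vector_field A (D' X Y)"
    if "vector_field A X" "vector_field A Y" for X Y
    using levi_civitaD(1)[OF D that] levi_civitaD(1)[OF D' that] .
  define t where "t X Y Z p = g p (D X Y p) (Z p) - g p (D' X Y p) (Z p)" for X Y Z p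
  have tan: "X p \<in> tangent_space A p" if "vector_field A X" for X p
    using that by (simp add: vector_field_def)
  have lin: "g p (tlin 1 v (-1) w) z = g p v z - g p w z"
    if "v \<in> tangent_space A p" "w \<in> tangent_space A p" "z \<in> tangent_space A p" for p v w z
  proof -
    have "g p (tlin 1 v (-1) w) z = 1 * g p v z + (-1) * g p w z"
      using g that unfolding riemannian_metric_def by blast
    then show ?thesis by simp
  qed
  have gsym: "g p v w = g p w v" if "v \<in> tangent_space A p" "w \<in> tangent_space A p" for p v w
    using g that unfolding riemannian_metric_def by blast
  have sym: "t X Y Z p = t Y X Z p"
    if "vector_field A X" "vector_field A Y" "vector_field A Z" for X Y Z p
  proof -
    have "D X Y p u - D Y X p u = D' X Y p u - D' Y X p u" for u
      using levi_civitaD(2)[OF D that(1,2)] levi_civitaD(2)[OF D' that(1,2)] by simp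
    then have "tlin 1 (D X Y p) (-1) (D Y X p) = tlin 1 (D' X Y p) (-1) (D' Y X p)"
      by (simp add: tlin_def fun_eq_iff)
    then have "g p (D X Y p) (Z p) - g p (D Y X p) (Z p)
        = g p (D' X Y p) (Z p) - g p (D' Y X p) (Z p)"
      using that by (simp add: lin[symmetric] tan vf)
    then show ?thesis by (simp add: t_def)
  qed
  have skew: "t X Y Z p = - t X Z Y p"
    if "vector_field A X" "vector_field A Y" "vector_field A Z" for X Y Z p
  proof -
    have "g p (D X Y p) (Z p) + g p (Y p) (D X Z p) = g p (D' X Y p) (Z p) + g p (Y p) (D' X Z p)"
      using levi_civitaD(3)[OF D that] levi_civitaD(3)[OF D' that] by simp
    moreover have "g p (Y p) (D X Z p) = g p (D X Z p) (Y p)"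
        "g p (Y p) (D' X Z p) = g p (D' X Z p) (Y p)"
      using that by (auto intro!: gsym tan vf)
    ultimately show ?thesis by (simp add: t_def)
  qed
  show ?thesis
  proof (rule vector_field_eqI[OF A g vf(1)[OF X Y] vf(2)[OF X Y]])
    fix Z p assume Z: "vector_field A Z"
    have "t X Y Z p = 0"
      using sym[OF X Y Z, of p] skew[OF Y X Z, of p] sym[OF Y Z X, of p]
        skew[OF Z Y X, of p] sym[OF Z X Y, of p] skew[OF X Z Y, of p] by simp
    then show "g p (D X Y p) (Z p) = g p (D' X Y p) (Z p)" by (simp add: t_def)
  qed
qed

end

theory Submission
  imports Defs
begin

text \<open>
  The Levi-Civita connections \<open>D\<close> of \<open>e\<^bsup>2\<sigma>\<^esup>g\<close> and \<open>\<nabla>\<close> of \<open>g\<close> satisfy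
  \<open>g(D\<^sub>X Y - \<nabla>\<^sub>X Y, Z) = X\<sigma> g(Y, Z) + Y\<sigma> g(X, Z) - Z\<sigma> g(X, Y)\<close>. If \<open>D\<^sub>X V\<close> is always a multiple of
  \<open>V\<close>, take \<open>Y = V\<close> and \<open>X = Z\<close> orthogonal to \<open>V\<close> and nonzero at a given point, which is possible
  because the dimension is at least 2: this gives \<open>V\<sigma> = - f\<close>. Then \<open>X = V\<close> gives that \<open>Z\<sigma>\<close> is
  proportional to \<open>g(V, Z)\<close>, and \<open>Z = V\<close> determines the factor \<open>- f / g(V, V)\<close>. Conversely, if
  \<open>G = - f e\<^bsup>-2\<rho>\<^esup> V\<close> is the gradient of \<open>\<sigma>\<close>, the same formula defines \<open>D\<close>, and \<open>D\<^sub>X V = \<theta>(X) V\<close>.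
  Tangent vectors act only on globally smooth functions, so vector fields with prescribed
  behaviour at a point come from cut-off coordinate fields.
\<close>

section \<open>Calculus of $C^k$ functions\<close>

lemma Ck_on_subset:
  "Ck_on k S f \<Longrightarrow> T \<subseteq> S \<Longrightarrow> Ck_on k T f"
proof (induction k arbitrary: f)
  case 0
  then show ?case by (auto intro: continuous_on_subset)
next
  case (Suc k)
  then show ?case by (simp add: subset_iff)
qed

text \<open>\<open>Ck_on\<close> takes derivatives at a point of the whole space, so
  differentiability glues point by point. Openness is what glues continuity at level 0, to which the
  higher levels descend.\<close>

lemma Ck_on_Un:
  assumes "open S" "open T" "Ck_on k S f" "Ck_on k T f"
  shows "Ck_on k (S \<union> T) f"
  using assms(3,4)
proof (induction k arbitrary: f)
  case 0
  then show ?case using assms(1,2) by (simp add: continuous_on_open_Un)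
next
  case (Suc k)
  then show ?case by auto
qed

text \<open>Uniqueness of the derivative lets an explicit formula \<open>f'\<close> stand in for
  \<open>frechet_derivative\<close>, which is only given by choice.\<close>

lemma Ck_on_Suc_I:
  assumes "open S" "\<And>x. x \<in> S \<Longrightarrow> (f has_derivative f' x) (at x)"
    and "\<And>v. Ck_on k S (\<lambda>x. f' x v)"
  shows "Ck_on (Suc k) S f"
proof -
  have "frechet_derivative f (at x) v = f' x v" if "x \<in> S" for x v
    using frechet_derivative_at[OF assms(2)[OF that]] by metis
  then have "Ck_on k S (\<lambda>x. frechet_derivative f (at x) v)" for v
    by (intro Ck_on_cong[OF assms(1) _ assms(3)]) simp
  with assms(2) show ?thesis by (auto simp: differentiable_def)
qed

lemma Ck_on_Suc_D:
  assumes "Ck_on (Suc k) S f" "x \<in> S"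
  shows "(f has_derivative frechet_derivative f (at x)) (at x)"
  using assms by (simp add: frechet_derivative_works)

lemma Ck_on_Suc_imp:
  assumes "Ck_on (Suc k) S f"
  shows "Ck_on k S f"
  using assms
proof (induction k arbitrary: f)
  case 0
  then have "continuous (at x) f" if "x \<in> S" for x
    using that by (simp add: differentiable_imp_continuous_within)
  then show ?case by (simp add: continuous_at_imp_continuous_on)
next
  case (Suc k)
  have "Ck_on k S (\<lambda>x. frechet_derivative f (at x) v)" for v
    by (rule Suc.IH) (use Suc.prems in simp)
  then show ?case using Suc.prems by simp
qed

lemma Ck_on_const: "Ck_on k S (\<lambda>_. c)"
  by (induction k arbitrary: c) auto

lemma Ck_on_ident: "open S \<Longrightarrow> Ck_on k S (\<lambda>x. x)"
proof (cases k)
  case (Suc k)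
  assume "open S"
  then show ?thesis unfolding Suc
    by (rule Ck_on_Suc_I[where f' = "\<lambda>_ v. v"]) (auto intro: Ck_on_const)
qed simp

lemma Ck_on_add:
  assumes "open S" "Ck_on k S f" "Ck_on k S g"
  shows "Ck_on k S (\<lambda>x. f x + g x)"
proof -
  have "Ck_on k S (\<lambda>x. f x - (0 - g x))"
    by (intro Ck_on_diff Ck_on_const assms)
  then show ?thesis by simp
qed

lemma Ck_on_sum:
  assumes "open S" "\<And>i. i \<in> I \<Longrightarrow> Ck_on k S (f i)"
  shows "Ck_on k S (\<lambda>x. \<Sum>i\<in>I. f i x)"
  using assms(2)
  by (induction I rule: infinite_finite_induct) (auto intro: Ck_on_const Ck_on_add assms(1))

text \<open>By the Leibniz rule the derivative is again a sum of two values of \<open>pr\<close>,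
  with factors of one class lower, so the induction must range over all pairs of factors.\<close>

lemma Ck_on_bilinear:
  assumes "bounded_bilinear pr" "open S" "Ck_on k S f" "Ck_on k S g"
  shows "Ck_on k S (\<lambda>x. pr (f x) (g x))"
  using assms(3,4)
proof (induction k arbitrary: f g)
  case 0
  then show ?case using bounded_bilinear.continuous_on[OF assms(1)] by simp
next
  case (Suc k)
  show ?case
  proof (rule Ck_on_Suc_I[OF assms(2)])
    fix x assume x: "x \<in> S"
    show "((\<lambda>x. pr (f x) (g x)) has_derivative
      (\<lambda>v. pr (f x) (frechet_derivative g (at x) v) + pr (frechet_derivative f (at x) v) (g x)))
      (at x)"
      by (rule bounded_bilinear.FDERIV[OF assms(1) Ck_on_Suc_D Ck_on_Suc_D]) (use Suc.prems x in auto)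
  next
    fix v
    show "Ck_on k S (\<lambda>x. pr (f x) (frechet_derivative g (at x) v) +
        pr (frechet_derivative f (at x) v) (g x))"
      using Suc.prems Ck_on_Suc_imp[OF Suc.prems(1)] Ck_on_Suc_imp[OF Suc.prems(2)]
      by (intro Ck_on_add assms(2) Suc.IH) simp_all
  qed
qed

lemmas Ck_on_mult = Ck_on_bilinear[OF bounded_bilinear_mult]
lemmas Ck_on_scaleR = Ck_on_bilinear[OF bounded_bilinear_scaleR]
lemmas Ck_on_inner = Ck_on_bilinear[OF bounded_bilinear_inner]

lemma Ck_on_compose:
  fixes f :: "'a::euclidean_space \<Rightarrow> 'b::euclidean_space" and h :: "'b \<Rightarrow> 'c::real_normed_vector"
  assumes "open S" "f ` S \<subseteq> T" "Ck_on k S f" "Ck_on k T h"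
  shows "Ck_on k S (\<lambda>x. h (f x))"
  using assms(3,4)
proof (induction k arbitrary: h)
  case 0
  then show ?case using assms(2) by (auto intro: continuous_on_compose2)
next
  case (Suc k)
  let ?f' = "\<lambda>x. frechet_derivative f (at x)" and ?h' = "\<lambda>y. frechet_derivative h (at y)"
  note d = Ck_on_Suc_D[OF Suc.prems(1)]
  note dh = Ck_on_Suc_D[OF Suc.prems(2)]
  show ?case
  proof (rule Ck_on_Suc_I[OF assms(1)])
    fix x assume x: "x \<in> S"
    have "((\<lambda>x. h (f x)) has_derivative (\<lambda>v. ?h' (f x) (?f' x v))) (at x)"
      using has_derivative_compose[OF d[OF x] dh] x assms(2) by auto
    \<comment> \<open>The chain rule applies the derivative of \<open>h\<close> in a direction that
      varies with \<open>x\<close>, whereas \<open>Ck_on\<close> controls it only in fixed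
      directions. Expanding the direction in the basis leaves fixed directions \<open>i\<close>, to
      which the induction hypothesis applies.\<close>
    moreover have "?h' (f x) (?f' x v) = (\<Sum>i\<in>Basis. (?f' x v \<bullet> i) *\<^sub>R ?h' (f x) i)" for v
    proof -
      interpret linear "?h' (f x)"
        using dh[of "f x"] x assms(2) has_derivative_linear by blast
      have "?h' (f x) (?f' x v) = ?h' (f x) (\<Sum>i\<in>Basis. (?f' x v \<bullet> i) *\<^sub>R i)"
        by (simp add: euclidean_representation)
      then show ?thesis by (simp add: sum scaleR)
    qed
    ultimately show "((\<lambda>x. h (f x)) has_derivative
        (\<lambda>v. \<Sum>i\<in>Basis. (?f' x v \<bullet> i) *\<^sub>R ?h' (f x) i)) (at x)"
      by simp
  next
    fix v
    show "Ck_on k S (\<lambda>x. \<Sum>i\<in>Basis. (?f' x v \<bullet> i) *\<^sub>R ?h' (f x) i)"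
      using Suc.prems by (intro Ck_on_sum Ck_on_scaleR Ck_on_inner Ck_on_const assms(1) Suc.IH
        Ck_on_Suc_imp[OF Suc.prems(1)]) auto
  qed
qed

section \<open>Smooth functions of one real variable\<close>

lemma Ck_on_Suc_real:
  fixes h h' :: "real \<Rightarrow> real"
  assumes "open S" "\<And>x. x \<in> S \<Longrightarrow> (h has_real_derivative h' x) (at x)" "Ck_on k S h'"
  shows "Ck_on (Suc k) S h"
  using assms(2,3)
  by (intro Ck_on_Suc_I[OF assms(1), where f' = "\<lambda>x v. h' x * v"])
    (auto simp: has_field_derivative_def intro!: Ck_on_mult Ck_on_const assms(1))

lemma Ck_on_inverse: "Ck_on k {0<..} (inverse :: real \<Rightarrow> real)"
proof (induction k)
  case 0
  then show ?case by (auto intro!: continuous_intros)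
next
  case (Suc k)
  show ?case
  proof (rule Ck_on_Suc_real)
    show "(inverse has_real_derivative - 1 * (inverse x * inverse x)) (at x)" if "x \<in> {0<..}" for x :: real
      \<comment> \<open>Written as a product of two inverses, the derivative falls under the
        induction hypothesis.\<close>
      using that DERIV_inverse[of x UNIV] by (simp add: power2_eq_square numeral_2_eq_2)
    show "Ck_on k {0<..} (\<lambda>x::real. - 1 * (inverse x * inverse x))"
      by (intro Ck_on_mult Ck_on_const Suc) simp_all
  qed simp
qed

lemma Ck_on_exp: "Ck_on k UNIV (exp :: real \<Rightarrow> real)"
proof (induction k)
  case 0
  then show ?case by (auto intro!: continuous_intros)
next
  case (Suc k)
  show ?case by (rule Ck_on_Suc_real[OF _ DERIV_exp Suc]) simp
qed

text \<open>Termwise differentiation yields another everywhere convergent power series, so the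
  induction runs over all coefficient sequences at once.\<close>

lemma Ck_on_powser:
  fixes c :: "nat \<Rightarrow> real"
  assumes "\<And>x. summable (\<lambda>n. c n * x ^ n)"
  shows "Ck_on k UNIV (\<lambda>x. \<Sum>n. c n * x ^ n)"
  using assms
proof (induction k arbitrary: c)
  case 0
  then show ?case
    by (auto intro!: continuous_at_imp_continuous_on DERIV_isCont
      termdiffs_strong_converges_everywhere)
next
  case (Suc k)
  show ?case
    by (rule Ck_on_Suc_real[OF _ termdiffs_strong_converges_everywhere])
      (use Suc in \<open>auto intro!: Suc.IH termdiff_converges_all\<close>)
qed

text \<open>
  The second-order Taylor quotient \<open>(exp x - 1 - x) / x\<^sup>2\<close>, entire as a power series: it lets
  derivations be applied to \<open>exp \<circ> u\<close> by algebra alone.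
\<close>

definition exp_remainder :: "real \<Rightarrow> real" where
  "exp_remainder x = (\<Sum>n. inverse (fact (n + 2)) * x ^ n)"

lemma summable_exp_remainder: "summable (\<lambda>n. inverse (fact (n + 2)) * x ^ n :: real)"
proof (cases "x = 0")
  case False
  have "summable (\<lambda>n. inverse (fact (n + 2)) * x ^ (n + 2))"
    using summable_exp[of x] by (subst summable_iff_shift[of "\<lambda>n. inverse (fact n) * x ^ n"])
  then have "summable (\<lambda>n. (inverse (fact (n + 2)) * x ^ (n + 2)) * inverse (x ^ 2))"
    by (rule summable_mult2)
  moreover have "(a * x ^ (n + 2)) * inverse (x ^ 2) = a * x ^ n" for a n
    using False by (simp add: power_add power2_eq_square field_simps)
  ultimately show ?thesis by (simp only:)
qed (simp add: summable_mult)

lemma exp_eq_remainder: "exp x = 1 + x + x * (x * exp_remainder x)"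
proof -
  have "exp x = (\<Sum>n. inverse (fact n) * x ^ n)"
    by (simp add: exp_def scaleR_conv_of_real)
  also have "\<dots> = (\<Sum>n. inverse (fact (n + 2)) * x ^ (n + 2)) + (\<Sum>n<2. inverse (fact n) * x ^ n)"
    using suminf_split_initial_segment[OF summable_exp, of x 2] .
  also have "(\<Sum>n. inverse (fact (n + 2)) * x ^ (n + 2)) = x ^ 2 * exp_remainder x"
    unfolding exp_remainder_def
    by (subst suminf_mult[OF summable_exp_remainder, symmetric]) (simp add: power_add algebra_simps power2_eq_square)
  finally show ?thesis by (simp add: numeral_2_eq_2 algebra_simps)
qed

lemma Ck_on_exp_remainder: "Ck_on k UNIV exp_remainder"
  unfolding exp_remainder_def by (intro Ck_on_powser summable_exp_remainder)

text \<open>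
  The flat function \<open>exp (- 1 / t)\<close> is \<open>flat 0\<close>; the extra index makes the family
  closed under differentiation up to linear combinations.
\<close>

definition flat :: "nat \<Rightarrow> real \<Rightarrow> real" where
  "flat n t = (if t \<le> 0 then 0 else inverse t ^ n * exp (- inverse t))"

text \<open>From the right, \<open>inverse t\<close> tends to infinity and the exponential beats
  every power of it; from the left the function is constantly 0.\<close>

lemma flat_tendsto_0: "(flat n \<longlongrightarrow> 0) (at 0)"
proof -
  have "((\<lambda>t. inverse t ^ n / exp (inverse t)) \<longlongrightarrow> 0) (at_right (0::real))"
    using filterlim_compose[OF tendsto_power_div_exp_0 filterlim_inverse_at_top_right] .
  then have "(flat n \<longlongrightarrow> 0) (at_right 0)"
    by (rule Lim_transform_eventually)
      (auto simp: flat_def eventually_at_right_field exp_minus divide_inverse intro!: exI[of _ 1])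
  moreover have "(flat n \<longlongrightarrow> 0) (at_left 0)"
    by (rule tendsto_eventually) (auto simp: flat_def eventually_at_left_field intro!: exI[of _ "-1"])
  ultimately show ?thesis by (simp add: filterlim_at_split)
qed

lemma flat_has_derivative:
  "(flat n has_real_derivative flat (n + 2) t - n * flat (n + 1) t) (at t)"
proof -
  consider "t = 0" | "t > 0" | "t < 0" by linarith
  then show ?thesis
  proof cases
    case 1
    have "flat n 0 = 0" by (simp add: flat_def)
    \<comment> \<open>Dividing by \<open>h\<close> only raises the index, so the limit of the
      difference quotient at 0 is already known.\<close>
    have "flat n h / h = flat (n + 1) h" for h by (simp add: flat_def divide_inverse)
    then have "((\<lambda>h. (flat n (0 + h) - flat n 0) / h) \<longlongrightarrow> 0) (at 0)"
      using flat_tendsto_0[of "n + 1"] by (simp add: \<open>flat n 0 = 0\<close>)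
    then show ?thesis using 1 by (simp add: DERIV_def flat_def)
  next
    case 2
    have "((\<lambda>t. inverse t ^ n * exp (- inverse t)) has_real_derivative
        inverse t ^ n * (exp (- inverse t) * inverse t ^ 2) -
        n * inverse t ^ (n - 1) * inverse t ^ 2 * exp (- inverse t)) (at t)"
      using 2 by (auto intro!: derivative_eq_intros simp: power2_eq_square algebra_simps)
    \<comment> \<open>The exponent \<open>n - 1\<close> is truncated at \<open>n = 0\<close>, where
      the factor \<open>n\<close> removes the term; hence the case split.\<close>
    moreover have "inverse t ^ n * (exp (- inverse t) * inverse t ^ 2) -
        n * inverse t ^ (n - 1) * inverse t ^ 2 * exp (- inverse t) = flat (n + 2) t - n * flat (n + 1) t"
      using 2 by (cases n) (auto simp: flat_def power2_eq_square algebra_simps)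
    ultimately have "((\<lambda>t. inverse t ^ n * exp (- inverse t)) has_real_derivative
        flat (n + 2) t - n * flat (n + 1) t) (at t)"
      by simp
    then show ?thesis
      by (rule has_field_derivative_transform_within_open[of _ _ _ "{0<..}"])
        (use 2 in \<open>auto simp: flat_def\<close>)
  next
    case 3
    have "((\<lambda>t. 0) has_real_derivative flat (n + 2) t - n * flat (n + 1) t) (at t)"
      using 3 by (simp add: flat_def)
    then show ?thesis
      by (rule has_field_derivative_transform_within_open[of _ _ _ "{..<0}"])
        (use 3 in \<open>auto simp: flat_def\<close>)
  qed
qed

lemma Ck_on_flat: "Ck_on k UNIV (flat n)"
proof (induction k arbitrary: n)
  case 0
  then show ?case
    using flat_has_derivative by (auto intro!: continuous_at_imp_continuous_on DERIV_isCont)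
next
  case (Suc k)
  show ?case
    by (rule Ck_on_Suc_real[OF _ flat_has_derivative])
      (auto intro!: Ck_on_diff Ck_on_mult Ck_on_const Suc)
qed

section \<open>Functions and vector fields supported in a chart\<close>

text \<open>The squared distance is polynomial, hence smooth at the centre too. For
  \<open>r > 0\<close> the function is positive exactly on the open ball of radius \<open>r\<close>
  about \<open>a\<close>.\<close>

definition bump :: "'a::euclidean_space \<Rightarrow> real \<Rightarrow> 'a \<Rightarrow> real" where
  "bump a r x = flat 0 (r ^ 2 - (x - a) \<bullet> (x - a))"

lemma Ck_on_bump: "Ck_on k UNIV (bump a r)"
  unfolding bump_def
  by (intro Ck_on_compose[OF _ _ _ Ck_on_flat] Ck_on_diff Ck_on_inner Ck_on_const Ck_on_ident) auto

lemma bump_center: "r > 0 \<Longrightarrow> bump a r a \<noteq> 0"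
  by (simp add: bump_def flat_def not_le)

lemma bump_outside:
  assumes "r > 0" "x \<notin> cball a r"
  shows "bump a r x = 0"
proof -
  have "r < norm (x - a)" using assms(2) by (simp add: dist_norm norm_minus_commute)
  then have "r ^ 2 < (norm (x - a)) ^ 2" using assms(1) by (intro power_strict_mono) auto
  then show ?thesis by (simp add: bump_def flat_def power2_norm_eq_inner)
qed

section \<open>Smooth functions on the manifold, read in charts\<close>

lemma smooth_atlasD:
  assumes "smooth_atlas A" "(U, \<phi>) \<in> A"
  shows "open U" "open (\<phi> ` U)" "homeomorphism U (\<phi> ` U) \<phi> (inv_into U \<phi>)"
  using assms by (auto simp: smooth_atlas_def is_chart_def)

lemma chart_inv:
  assumes "smooth_atlas A" "(U, \<phi>) \<in> A"
  shows "q \<in> U \<Longrightarrow> inv_into U \<phi> (\<phi> q) = q"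
    and "x \<in> \<phi> ` U \<Longrightarrow> \<phi> (inv_into U \<phi> x) = x"
    and "x \<in> \<phi> ` U \<Longrightarrow> inv_into U \<phi> x \<in> U"
  using smooth_atlasD(3)[OF assms]
  by (auto simp: homeomorphism_apply1 homeomorphism_apply2 inv_into_into)

lemma chart_transition:
  assumes "smooth_atlas A" "(U, \<phi>) \<in> A" "(W, \<psi>) \<in> A"
  shows "Ck_on k (\<phi> ` (U \<inter> W)) (\<lambda>x. \<psi> (inv_into U \<phi> x))"
proof -
  have "\<forall>(U, \<phi>)\<in>A. \<forall>(W, \<psi>)\<in>A. smooth_on (\<phi> ` (U \<inter> W)) (\<psi> \<circ> inv_into U \<phi>)"
    using assms(1) unfolding smooth_atlas_def by blast
  from bspec[OF this assms(2)] have "\<forall>(W, \<psi>)\<in>A. smooth_on (\<phi> ` (U \<inter> W)) (\<psi> \<circ> inv_into U \<phi>)"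
    by simp
  from bspec[OF this assms(3)] show ?thesis by (simp add: smooth_on_def o_def)
qed

lemma open_chart_image:
  assumes "smooth_atlas A" "(U, \<phi>) \<in> A" "open S" "S \<subseteq> U"
  shows "open (\<phi> ` S)"
proof -
  have "openin (top_of_set U) S" using assms(3,4) by (simp add: openin_open_eq smooth_atlasD(1)[OF assms(1,2)])
  then have "openin (top_of_set (\<phi> ` U)) (\<phi> ` S)"
    using homeomorphism_imp_open_map[OF smooth_atlasD(3)[OF assms(1,2)]] by blast
  then show ?thesis using smooth_atlasD(2)[OF assms(1,2)] by (simp add: openin_open_eq)
qed

lemma smooth_fun_iff:
  "smooth_fun A u \<longleftrightarrow> (\<forall>(U, \<phi>)\<in>A. \<forall>k. Ck_on k (\<phi> ` U) (\<lambda>x. u (inv_into U \<phi> x)))"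
  by (simp add: smooth_fun_def smooth_on_def o_def)

lemma smooth_funD:
  "smooth_fun A u \<Longrightarrow> (U, \<phi>) \<in> A \<Longrightarrow> Ck_on k (\<phi> ` U) (\<lambda>x. u (inv_into U \<phi> x))"
  unfolding smooth_fun_iff by blast

lemma smooth_fun_const: "smooth_fun A (\<lambda>_. c)"
  by (auto simp: smooth_fun_iff Ck_on_const)

lemma smooth_fun_mult:
  assumes "smooth_atlas A" "smooth_fun A u" "smooth_fun A w"
  shows "smooth_fun A (\<lambda>q. u q * w q)"
  unfolding smooth_fun_iff
proof clarify
  fix U \<phi> k assume c: "(U, \<phi>) \<in> A"
  show "Ck_on k (\<phi> ` U) (\<lambda>x. u (inv_into U \<phi> x) * w (inv_into U \<phi> x))"
    by (intro Ck_on_mult smooth_atlasD(2)[OF assms(1) c] smooth_funD[OF assms(2) c] smooth_funD[OF assms(3) c])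
qed

lemma smooth_fun_add:
  assumes "smooth_atlas A" "smooth_fun A u" "smooth_fun A w"
  shows "smooth_fun A (\<lambda>q. u q + w q)"
  unfolding smooth_fun_iff
proof clarify
  fix U \<phi> k assume c: "(U, \<phi>) \<in> A"
  show "Ck_on k (\<phi> ` U) (\<lambda>x. u (inv_into U \<phi> x) + w (inv_into U \<phi> x))"
    by (intro Ck_on_add smooth_atlasD(2)[OF assms(1) c] smooth_funD[OF assms(2) c] smooth_funD[OF assms(3) c])
qed

text \<open>The set \<open>T\<close> admits outer functions that are smooth on part of the line
  only, such as \<open>inverse\<close> on the positive reals.\<close>

lemma smooth_fun_compose:
  assumes "smooth_atlas A" "smooth_fun A u" "\<And>k. Ck_on k T h" "range u \<subseteq> T"
  shows "smooth_fun A (\<lambda>q. h (u q))"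
  unfolding smooth_fun_iff
proof clarify
  fix U \<phi> k assume "(U, \<phi>) \<in> A"
  then show "Ck_on k (\<phi> ` U) (\<lambda>x. h (u (inv_into U \<phi> x)))"
    using assms(4)
    by (intro Ck_on_compose[OF smooth_atlasD(2)[OF assms(1)] _ smooth_funD[OF assms(2)] assms(3)]) auto
qed

text \<open>Let \<open>L\<close> be the part of \<open>U\<close> that the chart sends to
  \<open>K\<close>. Any other chart domain \<open>W\<close> is covered by
  \<open>W \<inter> U\<close>, where the extension is \<open>h\<close> after a transition map, and
  by \<open>W - L\<close>, where it is 0.\<close>

lemma smooth_fun_extend_0:
  assumes A: "smooth_atlas A" "(U, \<phi>) \<in> A"
    and h: "\<And>k. Ck_on k (\<phi> ` U) h"
    and K: "compact K" "K \<subseteq> \<phi> ` U" "\<And>x. x \<in> \<phi> ` U - K \<Longrightarrow> h x = 0"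
  shows "smooth_fun A (\<lambda>q. if q \<in> U then h (\<phi> q) else 0)"
  unfolding smooth_fun_iff
proof clarify
  fix W \<psi> k assume W: "(W, \<psi>) \<in> A"
  define L where "L = inv_into U \<phi> ` K"
  define e where "e = (\<lambda>q. if q \<in> U then h (\<phi> q) else 0)"
  have "continuous_on K (inv_into U \<phi>)"
    using smooth_atlasD(3)[OF A] K(2) by (auto simp: homeomorphism_def intro: continuous_on_subset)
  \<comment> \<open>Here the Hausdorff property enters: the compact set \<open>L\<close> is closed
    in the whole manifold, which makes \<open>W - L\<close> open.\<close>
  then have L: "closed L"
    unfolding L_def using K(1) by (intro compact_imp_closed compact_continuous_image)
  have zero: "e q = 0" if "q \<notin> L" for q
  proof (cases "q \<in> U")
    case True
    then have "\<phi> q \<notin> K" using that chart_inv(1)[OF A] unfolding L_def by force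
    then show ?thesis using True K(3) by (simp add: e_def)
  qed (simp add: e_def)
  have "L \<subseteq> U" unfolding L_def using K(2) chart_inv(3)[OF A] by blast
  then have cover: "\<psi> ` W = \<psi> ` (W \<inter> U) \<union> \<psi> ` (W - L)" by auto
  have opn: "open (\<psi> ` (W \<inter> U))" "open (\<psi> ` (W - L))"
    using smooth_atlasD(1)[OF A] smooth_atlasD(1)[OF A(1) W] L
    by (auto intro!: open_chart_image[OF A(1) W] open_Diff open_Int)
  have "Ck_on k (\<psi> ` (W \<inter> U)) (\<lambda>x. h (\<phi> (inv_into W \<psi> x)))"
  proof (rule Ck_on_compose[OF opn(1) _ _ h])
    show "(\<lambda>x. \<phi> (inv_into W \<psi> x)) ` \<psi> ` (W \<inter> U) \<subseteq> \<phi> ` U"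
      using chart_inv(1)[OF A(1) W] by auto
    show "Ck_on k (\<psi> ` (W \<inter> U)) (\<lambda>x. \<phi> (inv_into W \<psi> x))"
      by (rule chart_transition[OF A(1) W A(2)])
  qed
  then have "Ck_on k (\<psi> ` (W \<inter> U)) (\<lambda>x. e (inv_into W \<psi> x))"
    by (rule Ck_on_cong[OF opn(1), rotated]) (auto simp: e_def chart_inv(1)[OF A(1) W])
  moreover have "Ck_on k (\<psi> ` (W - L)) (\<lambda>x. e (inv_into W \<psi> x))"
    by (rule Ck_on_cong[OF opn(2) _ Ck_on_const[of _ _ 0]]) (auto simp: zero chart_inv(1)[OF A(1) W])
  ultimately have "Ck_on k (\<psi> ` W) (\<lambda>x. e (inv_into W \<psi> x))"
    unfolding cover by (intro Ck_on_Un opn)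
  then show "Ck_on k (\<psi> ` W) (\<lambda>x. if inv_into W \<psi> x \<in> U then h (\<phi> (inv_into W \<psi> x)) else 0)"
    by (simp add: e_def)
qed

text \<open>The coordinate derivative in direction \<open>e\<close>, cut off by \<open>b\<close> and
  extended by 0 outside \<open>U\<close>. The test for smoothness of \<open>u\<close> meets the
  convention that tangent vectors vanish on non-smooth arguments.\<close>

definition chart_field ::
  "('m::{t2_space, second_countable_topology}, 'e::euclidean_space) chart set \<Rightarrow> 'm set \<Rightarrow> ('m \<Rightarrow> 'e) \<Rightarrow>
    ('e \<Rightarrow> real) \<Rightarrow> 'e \<Rightarrow> 'm vfield" where
  "chart_field A U \<phi> b e = (\<lambda>q u.
     if q \<in> U \<and> smooth_fun A u
     then b (\<phi> q) * frechet_derivative (\<lambda>x. u (inv_into U \<phi> x)) (at (\<phi> q)) e else 0)"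

text \<open>On \<open>U\<close> the derivation laws are those of the Frechet derivative, and outside
  \<open>U\<close> the value is the zero derivation. Smoothness is extension by zero, since
  \<open>b\<close> vanishes off the compact set \<open>K\<close>.\<close>

lemma chart_field_vector_field:
  assumes A: "smooth_atlas A" "(U, \<phi>) \<in> A"
    and b: "\<And>k. Ck_on k UNIV b" "\<And>x. x \<notin> K \<Longrightarrow> b x = 0"
    and K: "compact K" "K \<subseteq> \<phi> ` U"
  shows "vector_field A (chart_field A U \<phi> b e)"
  unfolding vector_field_def
proof (intro conjI allI impI)
  fix q
  show "chart_field A U \<phi> b e q \<in> tangent_space A q"
  proof (cases "q \<in> U")
    case True
    let ?D = "\<lambda>u. frechet_derivative (\<lambda>x. u (inv_into U \<phi> x)) (at (\<phi> q))"
    have d: "((\<lambda>x. u (inv_into U \<phi> x)) has_derivative ?D u) (at (\<phi> q))" if "smooth_fun A u" for u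
      using Ck_on_Suc_D[OF smooth_funD[OF that A(2), of "Suc 0"]] True by simp
    have "?D (\<lambda>q. c * u q + d' * w q) e = c * ?D u e + d' * ?D w e"
      if "smooth_fun A u" "smooth_fun A w" for c d' u w
      using fun_cong[OF frechet_derivative_at[OF has_derivative_add[OF
          has_derivative_mult_right[OF d[OF that(1)], of c]
          has_derivative_mult_right[OF d[OF that(2)], of d']]], of e]
      by simp
    moreover have "?D (\<lambda>q. u q * w q) e = u q * ?D w e + w q * ?D u e"
      if "smooth_fun A u" "smooth_fun A w" for u w
      using fun_cong[OF frechet_derivative_at[OF has_derivative_mult[OF d[OF that(1)] d[OF that(2)]]], of e]
      by (simp add: chart_inv(1)[OF A True] mult.commute)
    ultimately show ?thesis
      unfolding tangent_space_def chart_field_def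
      using True A(1)
      by (auto simp: smooth_fun_add smooth_fun_mult smooth_fun_const algebra_simps)
  qed (auto simp: tangent_space_def chart_field_def)
next
  fix u assume u: "smooth_fun A u"
  let ?h = "\<lambda>x. b x * frechet_derivative (\<lambda>x. u (inv_into U \<phi> x)) (at x) e"
  have "smooth_fun A (\<lambda>q. if q \<in> U then ?h (\<phi> q) else 0)"
  proof (rule smooth_fun_extend_0[OF A _ K])
    fix k
    show "Ck_on k (\<phi> ` U) ?h"
      using smooth_funD[OF u A(2), of "Suc k"] Ck_on_subset[OF b(1)]
      by (intro Ck_on_mult smooth_atlasD(2)[OF A]) auto
  qed (use b(2) in auto)
  then show "smooth_fun A (\<lambda>p. chart_field A U \<phi> b e p u)"
    using u by (simp add: chart_field_def)
qed

lemma vector_field_lin: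
  assumes "smooth_atlas A" "vector_field A X" "vector_field A Y" "smooth_fun A a" "smooth_fun A b"
  shows "vector_field A (vlin a X b Y)"
  unfolding vector_field_def
proof (intro conjI allI impI)
  fix u assume "smooth_fun A u"
  then show "smooth_fun A (\<lambda>p. vlin a X b Y p u)"
    using assms unfolding vlin_def tlin_def vector_field_def
    by (intro smooth_fun_add smooth_fun_mult) auto
next
  fix p
  show "vlin a X b Y p \<in> tangent_space A p"
    using assms(2,3) unfolding vlin_def tlin_def vector_field_def tangent_space_def
    by (auto simp: algebra_simps)
qed

lemma vscale_eq_vlin: "vscale a X = vlin a X (\<lambda>_. 0) X"
  by (simp add: vscale_def vlin_def tlin_def)

lemma vector_field_scale:
  assumes "smooth_atlas A" "vector_field A X" "smooth_fun A a"
  shows "vector_field A (vscale a X)"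
  unfolding vscale_eq_vlin by (intro vector_field_lin assms smooth_fun_const)

text \<open>Two cut-off coordinate fields are tested on cut-off coordinate functions
  \<open>w l\<close> centred at \<open>p\<close>. The resulting matrix of values at \<open>p\<close>
  is diagonal with nonzero entries.\<close>

lemma independent_vector_fields:
  fixes A :: "('m::{t2_space, second_countable_topology}, 'e::euclidean_space) chart set"
  assumes A: "smooth_atlas A" and dim: "DIM('e) \<ge> 2"
  obtains X Y where "vector_field A X" "vector_field A Y"
    and "\<And>a b. tlin a (X p) b (Y p) = (\<lambda>_. 0) \<Longrightarrow> a = 0 \<and> b = 0"
proof -
  obtain U \<phi> where c: "(U, \<phi>) \<in> A" and p: "p \<in> U"
    using A unfolding smooth_atlas_def by blast
  obtain r where r: "r > 0" "cball (\<phi> p) r \<subseteq> \<phi> ` U"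
    using smooth_atlasD(2)[OF A c] p open_contains_cball by blast
  define b where "b = bump (\<phi> p) r"
  have b: "Ck_on k S b" for k S
    unfolding b_def using Ck_on_subset[OF Ck_on_bump] by blast
  have b0: "b x = 0" if "x \<notin> cball (\<phi> p) r" for x
    unfolding b_def using bump_outside[OF r(1) that] .
  have bp: "b (\<phi> p) \<noteq> 0" unfolding b_def by (rule bump_center[OF r(1)])
  obtain i j :: 'e where ij: "i \<in> Basis" "j \<in> Basis" "i \<noteq> j"
    using dim card_le_Suc0_iff_eq[of "Basis :: 'e set"] by fastforce
  let ?X = "chart_field A U \<phi> b"
  have vf: "vector_field A (?X e)" for e
    by (rule chart_field_vector_field[OF A c b b0 _ r(2)]) auto
  define w where "w l q = (if q \<in> U then b (\<phi> q) * ((\<phi> q - \<phi> p) \<bullet> l) else 0)" for l q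
  have w: "smooth_fun A (w l)" for l
    unfolding w_def
    by (rule smooth_fun_extend_0[OF A c _ _ r(2)])
      (auto simp: b0 smooth_atlasD(2)[OF A c] intro!: Ck_on_mult b Ck_on_inner Ck_on_diff Ck_on_ident Ck_on_const)
  \<comment> \<open>The linear factor of \<open>w l\<close> vanishes at \<open>p\<close>, so the
    derivative of \<open>b\<close> drops out. One factor \<open>b (\<phi> p)\<close> comes from the
    field and the other from \<open>w l\<close>.\<close>
  have Xw: "?X e p (w l) = b (\<phi> p) * (b (\<phi> p) * (e \<bullet> l))" for e l
  proof -
    have db: "(b has_derivative frechet_derivative b (at (\<phi> p))) (at (\<phi> p))"
      by (rule Ck_on_Suc_D[where k = 0 and S = UNIV, OF b]) simp
    have "((\<lambda>x. b x * ((x - \<phi> p) \<bullet> l)) has_derivative (\<lambda>v. b (\<phi> p) * (v \<bullet> l))) (at (\<phi> p))"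
      by (auto intro!: derivative_eq_intros db)
    then have "((\<lambda>x. w l (inv_into U \<phi> x)) has_derivative (\<lambda>v. b (\<phi> p) * (v \<bullet> l))) (at (\<phi> p))"
      by (rule has_derivative_transform_within_open[OF _ smooth_atlasD(2)[OF A c]])
        (use p in \<open>auto simp: w_def chart_inv[OF A c]\<close>)
    from fun_cong[OF frechet_derivative_at[OF this], of e] show ?thesis
      using p w by (simp add: chart_field_def)
  qed
  show thesis
  proof (rule that[OF vf vf])
    fix s t assume "tlin s (?X i p) t (?X j p) = (\<lambda>_. 0)"
    then have "s * ?X i p (w l) + t * ?X j p (w l) = 0" for l
      by (simp add: tlin_def fun_eq_iff)
    from this[of i] this[of j] show "s = 0 \<and> t = 0"
      using ij bp by (simp add: Xw inner_Basis inner_not_same_Basis)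
  qed
qed

section \<open>Derivations at a point and the exponential\<close>

lemma tangent_const:
  assumes "v \<in> tangent_space A p"
  shows "v (\<lambda>_. c) = 0"
proof -
  have lin: "v (\<lambda>q. a * 1 + b * 1) = a * v (\<lambda>_. 1) + b * v (\<lambda>_. 1)" for a b
    using assms smooth_fun_const[of A 1] unfolding tangent_space_def by blast
  \<comment> \<open>The Leibniz rule for 1 = 1 * 1 says that the value at 1 is twice itself, hence
    0.\<close>
  have "v (\<lambda>q. 1 * 1) = 1 * v (\<lambda>_. 1) + 1 * v (\<lambda>_. 1)"
    using assms smooth_fun_const[of A 1] unfolding tangent_space_def by blast
  then show ?thesis using lin[of c 0] by simp
qed

lemma tangent_lin:
  assumes "v \<in> tangent_space A p" "smooth_fun A u" "smooth_fun A w"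
  shows "v (\<lambda>q. a * u q + b * w q) = a * v u + b * v w"
  using assms unfolding tangent_space_def by blast

lemma tangent_mult:
  assumes "v \<in> tangent_space A p" "smooth_fun A u" "smooth_fun A w"
  shows "v (\<lambda>q. u q * w q) = u p * v w + w p * v u"
  using assms unfolding tangent_space_def by blast

text \<open>A chain rule obtained from the derivation laws alone: \<open>exp (u q)\<close> is
  \<open>exp (u p)\<close> times \<open>1 + s q + s q * m q\<close>. As \<open>s\<close> and
  \<open>m\<close> both vanish at \<open>p\<close>, the Leibniz rule kills the last product.\<close>

lemma tangent_exp:
  assumes A: "smooth_atlas A" and v: "v \<in> tangent_space A p" and u: "smooth_fun A u"
  shows "v (\<lambda>q. exp (u q)) = exp (u p) * v u"
proof -
  define s where "s q = u q - u p" for q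
  define m where "m q = s q * exp_remainder (s q)" for q
  have s: "smooth_fun A s"
    unfolding s_def by (intro smooth_fun_diff A u smooth_fun_const)
  have m: "smooth_fun A m"
    unfolding m_def by (intro smooth_fun_mult A s smooth_fun_compose[OF A s Ck_on_exp_remainder]) auto
  have "v s = v u"
    using tangent_lin[OF v u smooth_fun_const[of A 1], of 1 "- u p"] tangent_const[OF v]
    by (simp add: s_def[abs_def])
  have "exp (u q) = exp (u p) * (1 + s q) + exp (u p) * (s q * m q)" for q
  proof -
    have "exp (u q) = exp (u p) * exp (s q)"
      by (simp add: s_def exp_add[symmetric])
    then show ?thesis
      unfolding m_def exp_eq_remainder[of "s q"] by (simp add: distrib_left)
  qed
  then have "v (\<lambda>q. exp (u q)) = v (\<lambda>q. exp (u p) * (1 + s q) + exp (u p) * (s q * m q))"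
    by (intro arg_cong[where f = v] ext)
  also have "\<dots> = exp (u p) * v (\<lambda>q. 1 * 1 + 1 * s q) + exp (u p) * v (\<lambda>q. s q * m q)"
    using tangent_lin[OF v smooth_fun_add[OF A smooth_fun_const[of A 1] s] smooth_fun_mult[OF A s m]]
    by simp
  also have "v (\<lambda>q. 1 * 1 + 1 * s q) = v s"
    using tangent_lin[OF v smooth_fun_const[of A 1] s, of 1 1] tangent_const[OF v] by simp
  also have "v (\<lambda>q. s q * m q) = 0"
    using tangent_mult[OF v s m] by (simp add: s_def m_def)
  finally show ?thesis using \<open>v s = v u\<close> by simp
qed

section \<open>Conformal change of the metric\<close>

lemma vector_field_tangent: "vector_field A X \<Longrightarrow> X p \<in> tangent_space A p"
  by (simp add: vector_field_def)

lemma vector_field_smooth: "vector_field A X \<Longrightarrow> smooth_fun A u \<Longrightarrow> smooth_fun A (\<lambda>p. X p u)"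
  by (simp add: vector_field_def)

lemma metric_sym:
  assumes "riemannian_metric A g" "v \<in> tangent_space A p" "w \<in> tangent_space A p"
  shows "g p v w = g p w v"
  using assms unfolding riemannian_metric_def by blast

lemma tlin_tangent:
  "v \<in> tangent_space A p \<Longrightarrow> w \<in> tangent_space A p \<Longrightarrow> tlin a v b w \<in> tangent_space A p"
  unfolding tangent_space_def tlin_def by (auto simp: algebra_simps)

lemma metric_lin:
  assumes "riemannian_metric A g" "v \<in> tangent_space A p" "w \<in> tangent_space A p"
    "z \<in> tangent_space A p"
  shows "g p (tlin a v b w) z = a * g p v z + b * g p w z"
    and "g p z (tlin a v b w) = a * g p z v + b * g p z w"
proof -
  show *: "g p (tlin a v b w) z = a * g p v z + b * g p w z"
    using assms unfolding riemannian_metric_def by blast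
  show "g p z (tlin a v b w) = a * g p z v + b * g p z w"
    using * metric_sym[OF assms(1) assms(4) tlin_tangent[OF assms(2,3)]]
      metric_sym[OF assms(1,4,2)] metric_sym[OF assms(1,4,3)] by simp
qed

lemma metric_smooth:
  assumes "riemannian_metric A g" "vector_field A X" "vector_field A Y"
  shows "smooth_fun A (\<lambda>p. g p (X p) (Y p))"
  using assms unfolding riemannian_metric_def by blast

lemma metric_pos:
  assumes "riemannian_metric A g" "v \<in> tangent_space A p" "v \<noteq> (\<lambda>_. 0)"
  shows "g p v v > 0"
  using assms unfolding riemannian_metric_def by blast

lemma orthogonal_vector_field:
  fixes A :: "('m::{t2_space, second_countable_topology}, 'e::euclidean_space) chart set"
  assumes A: "smooth_atlas A" and dim: "DIM('e) \<ge> 2" and g: "riemannian_metric A g"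
    and v: "v \<in> tangent_space A p"
  obtains X where "vector_field A X" "X p \<noteq> (\<lambda>_. 0)" "g p (X p) v = 0"
proof -
  obtain X Y where X: "vector_field A X" and Y: "vector_field A Y"
    and ind: "\<And>a b. tlin a (X p) b (Y p) = (\<lambda>_. 0) \<Longrightarrow> a = 0 \<and> b = 0"
    using independent_vector_fields[OF A dim] by metis
  have X0: "X p \<noteq> (\<lambda>_. 0)" using ind[of 1 0] by (auto simp: tlin_def)
  show thesis
  proof (cases "g p (X p) v = 0")
    case True
    with X X0 that show thesis by blast
  next
    case False
    \<comment> \<open>The coefficients are constants, namely values at \<open>p\<close>, so
      smoothness is immediate and orthogonality is obtained at \<open>p\<close> only. The second
      coefficient is nonzero, so independence keeps the field from vanishing there.\<close>
    let ?Z = "vlin (\<lambda>_. g p (Y p) v) X (\<lambda>_. - g p (X p) v) Y"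
    show thesis
    proof (rule that[of ?Z])
      show "vector_field A ?Z" by (intro vector_field_lin A X Y smooth_fun_const)
      show "?Z p \<noteq> (\<lambda>_. 0)" using False ind unfolding vlin_def by fastforce
      show "g p (?Z p) v = 0"
        using metric_lin(1)[OF g X[THEN vector_field_tangent] Y[THEN vector_field_tangent] v]
        by (simp add: vlin_def)
    qed
  qed
qed

lemma conformal_metric_derivative:
  assumes A: "smooth_atlas A" and g: "riemannian_metric A g" and \<sigma>: "smooth_fun A \<sigma>"
    and v: "v \<in> tangent_space A p" and Y: "vector_field A Y" and Z: "vector_field A Z"
  shows "v (\<lambda>q. conformal_metric \<sigma> g q (Y q) (Z q)) =
    exp (2 * \<sigma> p) * (v (\<lambda>q. g q (Y q) (Z q)) + 2 * v \<sigma> * g p (Y p) (Z p))"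
proof -
  have s: "smooth_fun A (\<lambda>q. 2 * \<sigma> q)" by (intro smooth_fun_mult A \<sigma> smooth_fun_const)
  have e: "smooth_fun A (\<lambda>q. exp (2 * \<sigma> q))"
    by (rule smooth_fun_compose[OF A s Ck_on_exp]) auto
  have "v (\<lambda>q. 2 * \<sigma> q) = 2 * v \<sigma>"
    using tangent_lin[OF v \<sigma> \<sigma>, of 2 0] by simp
  then have "v (\<lambda>q. exp (2 * \<sigma> q)) = exp (2 * \<sigma> p) * (2 * v \<sigma>)"
    using tangent_exp[OF A v s] by simp
  then show ?thesis
    unfolding conformal_metric_def using tangent_mult[OF v e metric_smooth[OF g Y Z]]
    by (simp add: algebra_simps)
qed

text \<open>
  Koszul's argument applied to the difference tensor of the two connections. Pairing with \<open>Z\<close>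
  avoids having to construct the gradient of \<open>\<sigma>\<close>.
\<close>

lemma conformal_levi_civita_difference:
  assumes A: "smooth_atlas A" and g: "riemannian_metric A g" and \<sigma>: "smooth_fun A \<sigma>"
    and N: "levi_civita A g N" and D: "levi_civita A (conformal_metric \<sigma> g) D"
    and X: "vector_field A X" and Y: "vector_field A Y" and Z: "vector_field A Z"
  shows "g p (D X Y p) (Z p) - g p (N X Y p) (Z p) =
    X p \<sigma> * g p (Y p) (Z p) + Y p \<sigma> * g p (X p) (Z p) - Z p \<sigma> * g p (X p) (Y p)"
proof -
  define t where "t X Y Z = g p (D X Y p) (Z p) - g p (N X Y p) (Z p)" for X Y Z
  note tan = vector_field_tangent
  have vf: "vector_field A (N X Y)" "vector_field A (D X Y)"
    if "vector_field A X" "vector_field A Y" for X Y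
    using levi_civitaD(1)[OF N that] levi_civitaD(1)[OF D that] .
  \<comment> \<open>Both connections are torsion free, so the Lie brackets cancel in the
    difference.\<close>
  have sym: "t X Y Z = t Y X Z"
    if "vector_field A X" "vector_field A Y" "vector_field A Z" for X Y Z
  proof -
    have "D X Y p u - N X Y p u = D Y X p u - N Y X p u" for u
      using levi_civitaD(2)[OF D that(1,2), of p u] levi_civitaD(2)[OF N that(1,2), of p u] by simp
    then have "tlin 1 (D X Y p) (-1) (N X Y p) = tlin 1 (D Y X p) (-1) (N Y X p)"
      by (simp add: tlin_def fun_eq_iff)
    then have "g p (tlin 1 (D X Y p) (-1) (N X Y p)) (Z p) =
        g p (tlin 1 (D Y X p) (-1) (N Y X p)) (Z p)" by simp
    then show ?thesis
      using that by (simp add: t_def metric_lin(1)[OF g] tan vf)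
  qed
  \<comment> \<open>Metric compatibility of both connections: the right-hand side is the derivative
    of the conformal factor, and the common factor \<open>exp (2 * \<sigma> p)\<close>
    cancels.\<close>
  have compat: "t X Y Z + t X Z Y = 2 * X p \<sigma> * g p (Y p) (Z p)"
    if "vector_field A X" "vector_field A Y" "vector_field A Z" for X Y Z
  proof -
    have "exp (2 * \<sigma> p) * (g p (N X Y p) (Z p) + g p (Y p) (N X Z p) + 2 * X p \<sigma> * g p (Y p) (Z p))
        = exp (2 * \<sigma> p) * (g p (D X Y p) (Z p) + g p (Y p) (D X Z p))"
      using conformal_metric_derivative[OF A g \<sigma> tan[OF that(1)] that(2,3)]
        levi_civitaD(3)[OF N that] levi_civitaD(3)[OF D that]
      by (simp add: conformal_metric_def distrib_left)
    then show ?thesis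
      using that by (simp add: t_def metric_sym[OF g, of "Y p"] tan vf)
  qed
  have gs: "g p (Y p) (X p) = g p (X p) (Y p)" "g p (Z p) (X p) = g p (X p) (Z p)"
      "g p (Z p) (Y p) = g p (Y p) (Z p)"
    using X Y Z by (auto intro!: metric_sym[OF g] tan)
  \<comment> \<open>Adding the first two cyclic instances and subtracting the third leaves
    \<open>2 * t X Y Z\<close> by symmetry.\<close>
  show ?thesis
    using compat[OF X Y Z] compat[OF Y Z X] compat[OF Z X Y]
      sym[OF X Y Z] sym[OF Y Z X] sym[OF Z X Y]
    by (simp add: gs t_def[symmetric])
qed

text \<open>The classical formula for the Levi-Civita connection of the conformal metric, with
  \<open>G\<close> in the role of the gradient of \<open>\<sigma>\<close>.\<close>

definition conformal_connection ::
  "'m metric2 \<Rightarrow> 'm connection \<Rightarrow> ('m \<Rightarrow> real) \<Rightarrow> 'm vfield \<Rightarrow> 'm connection" where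
  "conformal_connection g N \<sigma> G = (\<lambda>X Y p u.
     N X Y p u + X p \<sigma> * Y p u + Y p \<sigma> * X p u - g p (X p) (Y p) * G p u)"

text \<open>As an iterated linear combination, the connection is open to the rules for vector fields
  and for the metric.\<close>

lemma conformal_connection_vlin:
  "conformal_connection g N \<sigma> G X Y =
    vlin (\<lambda>_. 1) (vlin (\<lambda>_. 1) (N X Y) (\<lambda>p. X p \<sigma>) Y)
      (\<lambda>_. 1) (vlin (\<lambda>p. Y p \<sigma>) X (\<lambda>p. - 1 * g p (X p) (Y p)) G)"
  by (simp add: conformal_connection_def vlin_def tlin_def fun_eq_iff algebra_simps)

lemma affine_connectionD:
  assumes "levi_civita A g D"
  shows "affine_connection A D"
  using assms by (simp add: levi_civita_def)

text \<open>The added terms are symmetric in \<open>X\<close> and \<open>Y\<close>, so torsion stays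
  0. In the compatibility identity the terms with \<open>Y p \<sigma>\<close> and
  \<open>Z p \<sigma>\<close> cancel; what remains is the derivative of the conformal
  factor.\<close>

lemma levi_civita_conformal_connection:
  assumes A: "smooth_atlas A" and g: "riemannian_metric A g" and \<sigma>: "smooth_fun A \<sigma>"
    and N: "levi_civita A g N" and G: "has_gradient A g \<sigma> G"
  shows "levi_civita A (conformal_metric \<sigma> g) (conformal_connection g N \<sigma> G)"
    (is "levi_civita A ?h ?D")
  unfolding levi_civita_def affine_connection_def
proof (intro conjI allI impI)
  note tan = vector_field_tangent
  note aff = affine_connectionD[OF N, unfolded affine_connection_def]
  have vG: "vector_field A G" using G by (simp add: has_gradient_def)
  have grad: "g p (G p) (X p) = X p \<sigma>" if "vector_field A X" for X p
    using G that by (simp add: has_gradient_def)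
  fix X Y assume X: "vector_field A X" and Y: "vector_field A Y"
  have vN: "vector_field A (N X Y)" by (rule levi_civitaD(1)[OF N X Y])
  show "vector_field A (?D X Y)"
    unfolding conformal_connection_vlin
    by (intro vector_field_lin A X Y vN vG smooth_fun_const smooth_fun_mult metric_smooth[OF g]
      vector_field_smooth[OF _ \<sigma>])
  show "?D X Y p u - ?D Y X p u = lie_bracket X Y p u" for p u
    using levi_civitaD(2)[OF N X Y, of p u] metric_sym[OF g tan[OF X] tan[OF Y], of p]
    by (simp add: conformal_connection_def algebra_simps)
  show "?D X (vscale a Y) = vlin (\<lambda>p. X p a) Y a (?D X Y)" if "smooth_fun A a" for a
  proof -
    have "N X (vscale a Y) = vlin (\<lambda>p. X p a) Y a (N X Y)" using aff X Y that by blast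
    moreover have "g p (X p) (vscale a Y p) = a p * g p (X p) (Y p)" for p
      using metric_lin(2)[OF g tan[OF Y] tan[OF Y] tan[OF X], of p "a p" 0]
      by (simp add: vscale_eq_vlin vlin_def)
    ultimately show ?thesis
      by (simp add: conformal_connection_def fun_eq_iff vlin_def tlin_def algebra_simps)
        (simp add: vscale_def algebra_simps)
  qed
  fix Z assume Z: "vector_field A Z"
  show "?D (vlin a X b Y) Z = vlin a (?D X Z) b (?D Y Z)" if "smooth_fun A a" "smooth_fun A b" for a b
  proof -
    have "N (vlin a X b Y) Z = vlin a (N X Z) b (N Y Z)" using aff X Y Z that by blast
    moreover have "g p (vlin a X b Y p) (Z p) = a p * g p (X p) (Z p) + b p * g p (Y p) (Z p)" for p
      using metric_lin(1)[OF g tan[OF X] tan[OF Y] tan[OF Z]] by (simp add: vlin_def)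
    ultimately show ?thesis
      by (simp add: conformal_connection_def fun_eq_iff)
        (simp add: vlin_def tlin_def algebra_simps)
  qed
  show "?D X (vlin (\<lambda>_. 1) Y (\<lambda>_. 1) Z) = vlin (\<lambda>_. 1) (?D X Y) (\<lambda>_. 1) (?D X Z)"
  proof -
    have "N X (vlin (\<lambda>_. 1) Y (\<lambda>_. 1) Z) = vlin (\<lambda>_. 1) (N X Y) (\<lambda>_. 1) (N X Z)"
      using aff X Y Z by blast
    moreover have "g p (X p) (vlin (\<lambda>_. 1) Y (\<lambda>_. 1) Z p) = g p (X p) (Y p) + g p (X p) (Z p)" for p
      using metric_lin(2)[OF g tan[OF Y] tan[OF Z] tan[OF X], of p 1 1] by (simp add: vlin_def)
    ultimately show ?thesis
      by (simp add: conformal_connection_def fun_eq_iff)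
        (simp add: vlin_def tlin_def algebra_simps)
  qed
  show "X p (\<lambda>q. ?h q (Y q) (Z q)) = ?h p (?D X Y p) (Z p) + ?h p (Y p) (?D X Z p)" for p
  proof -
    have vN': "vector_field A (N X Z)" by (rule levi_civitaD(1)[OF N X Z])
    note ts = tan[OF X, of p] tan[OF Y, of p] tan[OF Z, of p] tan[OF vG, of p] tan[OF vN, of p]
      tan[OF vN', of p]
    have DY: "g p (?D X Y p) (Z p) = g p (N X Y p) (Z p) + X p \<sigma> * g p (Y p) (Z p) +
        Y p \<sigma> * g p (X p) (Z p) - g p (X p) (Y p) * Z p \<sigma>"
      unfolding conformal_connection_vlin vlin_def
      by (simp add: metric_lin[OF g] tlin_tangent ts grad[OF Z])
    have DZ: "g p (Y p) (?D X Z p) = g p (Y p) (N X Z p) + X p \<sigma> * g p (Y p) (Z p) +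
        Z p \<sigma> * g p (X p) (Y p) - g p (X p) (Z p) * Y p \<sigma>"
      unfolding conformal_connection_vlin vlin_def
      using metric_sym[OF g ts(2,4)] metric_sym[OF g ts(2,1)]
      by (simp add: metric_lin[OF g] tlin_tangent ts grad[OF Y])
    have "?h p (?D X Y p) (Z p) + ?h p (Y p) (?D X Z p) = exp (2 * \<sigma> p) *
        (g p (N X Y p) (Z p) + g p (Y p) (N X Z p) + 2 * X p \<sigma> * g p (Y p) (Z p))"
      unfolding conformal_metric_def DY DZ by (simp add: algebra_simps)
    then show ?thesis
      using conformal_metric_derivative[OF A g \<sigma> ts(1) Y Z] levi_civitaD(3)[OF N X Y Z, of p]
      by simp
  qed
qed

section \<open>Torse-forming fields for two conformal metrics\<close>

lemma torse_formingD:
  assumes "torse_forming A D V f \<theta>"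
  shows "vector_field A V" "smooth_fun A f" "one_form A \<theta>"
    and "vector_field A X \<Longrightarrow> D X V = vlin f X (\<lambda>p. \<theta> p (X p)) V"
  using assms unfolding torse_forming_def by blast+

lemma torse_forming_conformal:
  fixes A :: "('m::{t2_space, second_countable_topology}, 'e::euclidean_space) chart set"
  assumes A: "smooth_atlas A" and dim: "DIM('e) \<ge> 2" and g: "riemannian_metric A g"
    and \<sigma>: "smooth_fun A \<sigma>"
    and N: "levi_civita A g N" and D: "levi_civita A (conformal_metric \<sigma> g) D"
    and V: "torse_forming A N V f \<theta>" and V': "torse_forming A D V f' \<theta>'"
    and V0: "\<And>p. V p \<noteq> (\<lambda>_. 0)"
    and X: "vector_field A X"
  shows "X p \<sigma> * g p (V p) (V p) = (f' p - f p) * g p (V p) (X p)"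
proof -
  note tan = vector_field_tangent
  note vV = torse_formingD(1)[OF V]
  have pos: "g p (V p) (V p) > 0" by (rule metric_pos[OF g tan[OF vV] V0])
  \<comment> \<open>This collects the coefficients of \<open>g p (V p) (Z p)\<close> once both
    torse-forming equations are put into the difference formula.\<close>
  define \<alpha> where "\<alpha> X = \<theta>' p (X p) - \<theta> p (X p) - X p \<sigma>" for X
  have key: "\<alpha> X * g p (V p) (Z p) = (V p \<sigma> - (f' p - f p)) * g p (X p) (Z p) - Z p \<sigma> * g p (X p) (V p)"
    if X: "vector_field A X" and Z: "vector_field A Z" for X Z
    using conformal_levi_civita_difference[OF A g \<sigma> N D X vV Z, of p]
    unfolding torse_formingD(4)[OF V X] torse_formingD(4)[OF V' X]
    by (simp add: vlin_def metric_lin(1)[OF g] tan X Z vV \<alpha>_def algebra_simps)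
  have "V p \<sigma> = f' p - f p"
  proof -
    \<comment> \<open>With \<open>X = Z = W\<close> every term containing
      \<open>g p (V p) (W p)\<close> disappears, and \<open>g p (W p) (W p)\<close> can be divided
      out.\<close>
    obtain W where W: "vector_field A W" "W p \<noteq> (\<lambda>_. 0)" "g p (W p) (V p) = 0"
      using orthogonal_vector_field[OF A dim g tan[OF vV]] by blast
    have "g p (V p) (W p) = 0" using W(3) metric_sym[OF g tan[OF vV] tan[OF W(1)]] by simp
    with key[OF W(1) W(1)] W(3) metric_pos[OF g tan[OF W(1)] W(2)] show ?thesis by simp
  qed
  with key[OF vV vV] have "(\<alpha> V + (f' p - f p)) * g p (V p) (V p) = 0"
    by (simp add: algebra_simps)
  with pos have "\<alpha> V = - (f' p - f p)" by simp
  with key[OF vV X] \<open>V p \<sigma> = f' p - f p\<close> show ?thesis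
    by (simp add: algebra_simps)
qed

theorem theorem2p1:
  fixes A :: "('m::{t2_space, second_countable_topology}, 'e::euclidean_space) chart set"
    and g :: "'m metric2" and nabla :: "'m connection" and V :: "'m vfield"
    and f \<rho> \<sigma> :: "'m \<Rightarrow> real" and \<theta> :: "'m form1"
  assumes "smooth_atlas A"
    and "DIM('e) \<ge> 2"
    and "riemannian_metric A g"
    and "levi_civita A g nabla"
    and "proper_torse_forming A nabla V f \<theta>"
    and "\<And>p. metric_norm g V p = exp (\<rho> p)"
    and "smooth_fun A \<sigma>"
  shows "recurrent A (conformal_metric \<sigma> g) V \<longleftrightarrow>
    has_gradient A g \<sigma> (vscale (\<lambda>p. - f p * exp (- 2 * \<rho> p)) V)"
proof -
  note A = assms(1) and g = assms(3) and N = assms(4) and \<sigma> = assms(7)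
  note tan = vector_field_tangent
  have V: "torse_forming A nabla V f \<theta>"
    using assms(5) by (simp add: proper_torse_forming_def)
  note vV = torse_formingD(1)[OF V]
  let ?G = "vscale (\<lambda>p. - f p * exp (- 2 * \<rho> p)) V"
  have "g p (V p) (V p) > 0" for p
    using assms(6)[of p] exp_gt_zero[of "\<rho> p"]
    unfolding metric_norm_def by (metis real_sqrt_gt_0_iff)
  have V0: "V p \<noteq> (\<lambda>_. 0)" for p
  proof
    assume 0: "V p = (\<lambda>_. 0)"
    have "g p (tlin 0 (V p) 0 (V p)) (V p) = 0"
      using metric_lin(1)[OF g tan[OF vV] tan[OF vV] tan[OF vV]] by simp
    moreover have "tlin 0 (V p) 0 (V p) = V p" using 0 by (simp add: tlin_def)
    ultimately show False using \<open>g p (V p) (V p) > 0\<close> by simp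
  qed
  have norm: "inverse (g p (V p) (V p)) = exp (- 2 * \<rho> p)" for p
  proof -
    have "g p (V p) (V p) = (metric_norm g V p) ^ 2"
      using \<open>g p (V p) (V p) > 0\<close> by (simp add: metric_norm_def)
    then show ?thesis by (simp add: assms(6) exp_double[symmetric] exp_minus)
  qed
  \<comment> \<open>Only the values of \<open>\<rho>\<close> are given, so smoothness of
    \<open>exp (- 2 * \<rho> p)\<close> is taken from the reciprocal of
    \<open>g p (V p) (V p)\<close>.\<close>
  have "smooth_fun A (\<lambda>p. - 1 * f p * inverse (g p (V p) (V p)))"
    using \<open>\<And>p. g p (V p) (V p) > 0\<close>
    by (intro smooth_fun_mult A smooth_fun_const torse_formingD(2)[OF V]
      smooth_fun_compose[OF A _ Ck_on_inverse] metric_smooth[OF g vV vV]) auto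
  then have vG: "vector_field A ?G"
    by (intro vector_field_scale A vV) (simp add: norm)
  have gG: "g p (?G p) (X p) = - f p * exp (- 2 * \<rho> p) * g p (V p) (X p)"
    if "vector_field A X" for X p
    using metric_lin(1)[OF g tan[OF vV] tan[OF vV] tan[OF that], of p _ 0]
    by (simp add: vscale_eq_vlin vlin_def)
  show ?thesis
  proof
    assume "recurrent A (conformal_metric \<sigma> g) V"
    then obtain D \<theta>' where D: "levi_civita A (conformal_metric \<sigma> g) D"
        "torse_forming A D V (\<lambda>_. 0) \<theta>'"
      unfolding recurrent_def by blast
    \<comment> \<open>Recurrence is the case in which the second torse-forming function is 0;
      dividing by the squared norm of \<open>V\<close> gives the gradient equation.\<close>
    have "g p (?G p) (X p) = X p \<sigma>" if X: "vector_field A X" for X p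
      using torse_forming_conformal[OF A assms(2) g \<sigma> N D(1) V D(2) V0 X, of p]
        \<open>g p (V p) (V p) > 0\<close>
      unfolding gG[OF X] unfolding norm[symmetric] by (simp add: field_simps)
    then show "has_gradient A g \<sigma> ?G" unfolding has_gradient_def using vG by blast
  next
    assume G: "has_gradient A g \<sigma> ?G"
    let ?D = "conformal_connection g nabla \<sigma> ?G"
    have d\<sigma>: "X p \<sigma> = - f p * exp (- 2 * \<rho> p) * g p (V p) (X p)" if "vector_field A X" for X p
      using G gG[OF that] that by (simp add: has_gradient_def)
    have V\<sigma>: "V p \<sigma> = - f p" for p
      using d\<sigma>[OF vV] \<open>g p (V p) (V p) > 0\<close> unfolding norm[symmetric] by simp
    \<comment> \<open>The term in \<open>X\<close> cancels because
      \<open>V p \<sigma> = - f p\<close>, and \<open>X p \<sigma>\<close> times \<open>V\<close>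
      cancels against the gradient term. Thus the same form \<open>\<theta>\<close> serves for the
      new connection.\<close>
    have "?D X V = vlin (\<lambda>_. 0) X (\<lambda>p. \<theta> p (X p)) V" if X: "vector_field A X" for X
    proof -
      have "g p (X p) (V p) = g p (V p) (X p)" for p
        by (rule metric_sym[OF g tan[OF X] tan[OF vV]])
      then show ?thesis
        unfolding conformal_connection_def torse_formingD(4)[OF V X] V\<sigma>
        by (simp add: d\<sigma>[OF X] vlin_def tlin_def vscale_def)
    qed
    then have "torse_forming A ?D V (\<lambda>_. 0) \<theta>"
      unfolding torse_forming_def using vV torse_formingD(3)[OF V] smooth_fun_const by blast
    moreover have "\<exists>p. form_nonzero_at A \<theta> p"
    proof -
      obtain S where "closure S = (UNIV :: 'm set)" "\<forall>p\<in>S. form_nonzero_at A \<theta> p"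
        using assms(5) unfolding proper_torse_forming_def by blast
      \<comment> \<open>A set whose closure is the whole nonempty manifold cannot be empty.\<close>
      then show ?thesis by (cases "S = {}") auto
    qed
    ultimately show "recurrent A (conformal_metric \<sigma> g) V"
      unfolding recurrent_def using levi_civita_conformal_connection[OF A g \<sigma> N G] by blast
  qed
qed

end
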